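(* Let $f,g:[0,1]\times[0,+\infty)\times\mathbb{R}\to[0,+\infty)$ be continuous, and define $k_1,k_2:[0,1]\times[0,1]\to\mathbb{R}$ by $$k_1(t,s)=\begin{cases}2-t,& s\le t,\\ 2-s,& s>t,\end{cases}\qquad k_2(t,s)=\frac12\begin{cases}1-2t,& s\le t,\\ 1-2s,& s>t.\end{cases}$$ Let $r_1,r_2>0$ and suppose that there exist two measurable functions $\underline{f},\underline{g}:[0,1]\to[0,+\infty)$ such that: (a) $f(t,u,v)\ge\underline{f}(t)$ for all $(t,u,v)\in[0,1]\times[r_1/2,r_1]\times[-r_2,r_2]$, and $$\sup_{t\in[0,1]}\int_0^1 k_1(t,s)\,\underline{f}(s)\,ds>0;$$ (b) $g(t,u,v)\ge\underline{g}(t)$ for all $(t,u,v)\in[0,1]\times[r_1/2,r_1]\times[-r_2,r_2]$, and $$\int_0^1\underline{g}(s)\,ds>0.$$ Then there exist $\lambda_{1,1},\lambda_{2,1},\lambda_{1,2}>0$, $\lambda_{2,2}<0$ and $(u_{0,j},v_{0,j})\in\overline{K}_{r_1}\times\overline{B}_{r_2}$, $j=1,2$, with $\|u_{0,j}\|_\infty=r_1$ and $\|v_{0,j}\|_\infty=r_2$, such that for $j=1,2$ and all $t\in[0,1]$ $$u_{0,j}(t)=\lambda_{1,j}\int_0^1 k_1(t,s)\,f(s,u_{0,j}(s),v_{0,j}(s))\,ds,$$ $$v_{0,j}(t)=\lambda_{2,j}\int_0^1 k_2(t,s)\,g(s,u_{0,j}(s),v_{0,j}(s))\,ds.$$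
   Context: $C[0,1]$ is the space of real continuous functions on $[0,1]$ with the norm $\|u\|_\infty=\max_{t\in[0,1]}|u(t)|$. The cone $K$ is $$K=\left\{u\in C[0,1]: u(t)\ge\left(1-\tfrac{t}{2}\right)\|u\|_\infty\ \text{for all } t\in[0,1]\right\}.$$ Notation: $\overline{K}_{r_1}=\{u\in K:\|u\|_\infty\le r_1\}$ and $\overline{B}_{r_2}=\{v\in C[0,1]:\|v\|_\infty\le r_2\}$. The integral system in the conclusion is the Hammerstein reformulation of the boundary value problem $u''+\lambda_1 f(t,u,v)=0$, $v''+\lambda_2 g(t,u,v)=0$ on $[0,1]$, $u'(0)=u(1)+u'(1)=0$, $v'(0)=v(1)-\frac12 v'(1)=0$. *)

theory Defs
  imports "HOL-Analysis.Analysis"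
begin

text \<open>
  Elements of C[0,1] are represented by functions on the whole real line of which only the
  values on [0,1] matter; every notion below depends on those values alone.
\<close>

definition C01 :: "(real \<Rightarrow> real) set" where
  "C01 = {u. continuous_on {0..1} u}"

text \<open>On \<open>C01\<close> the supremum is attained, so it is the maximum norm.\<close>

definition sup_norm01 :: "(real \<Rightarrow> real) \<Rightarrow> real" where
  "sup_norm01 u = (SUP t\<in>{0..1}. \<bar>u t\<bar>)"

definition cone_K :: "(real \<Rightarrow> real) set" where
  "cone_K = {u \<in> C01. \<forall>t\<in>{0..1}. u t \<ge> (1 - t / 2) * sup_norm01 u}"

definition Kbar :: "real \<Rightarrow> (real \<Rightarrow> real) set" where
  "Kbar r = {u \<in> cone_K. sup_norm01 u \<le> r}"

definition Bbar :: "real \<Rightarrow> (real \<Rightarrow> real) set" where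
  "Bbar r = {v \<in> C01. sup_norm01 v \<le> r}"

definition k1 :: "real \<Rightarrow> real \<Rightarrow> real" where
  "k1 t s = (if s \<le> t then 2 - t else 2 - s)"

definition k2 :: "real \<Rightarrow> real \<Rightarrow> real" where
  "k2 t s = 1 / 2 * (if s \<le> t then 1 - 2 * t else 1 - 2 * s)"

end

theory Submission
  imports Defs "HOL-Complex_Analysis.Great_Picard"
begin

text \<open>
  Both kernels have the form $c - \max(t,s)$, so the two components $F$, $G$ of the Hammerstein map are
  decreasing in $t$ and their norms are $F(0)$ and $\max(|G(0)|, |G(1)|)$; the lower bounds on $f$ and
  $g$ keep these away from zero. Since $F(t) \ge (1 - t/2) F(0)$, rescaling the components to norms
  $r_1$ and $r_2$ (and the second one by a sign) gives a continuous self-map with equi-Lipschitz image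
  of the convex set of pairs with values in $[r_1/2, r_1] \times [-r_2, r_2]$. A fixed point is an
  eigenpair, and the two signs give the two pairs. The fixed point comes from Schauder's theorem,
  obtained here from Kuhn's combinatorial lemma, whose dimension is an ordinary natural number, by a
  partition of unity and the Arzela--Ascoli theorem.
\<close>

section \<open>Brouwer's theorem on the cube of dimension n\<close>

text \<open>Kuhn's lemma on ever finer grids yields small cells in which, for every coordinate, F
  fails to decrease it at one vertex and fails to increase it at another; at a limit of such cells
  both inequalities become equality. Points are sequences of which only the first \<open>n\<close>
  entries matter, so that \<open>n\<close> can later be the size of a net that depends on the
  accuracy.\<close>

lemma brouwer_unit_cube_nat:
  fixes F :: "(nat \<Rightarrow> real) \<Rightarrow> nat \<Rightarrow> real"
  assumes maps: "\<And>x i. \<forall>j<n. x j \<in> {0..1} \<Longrightarrow> i < n \<Longrightarrow> F x i \<in> {0..1}"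
    and cont: "\<And>X x i. \<forall>k. \<forall>j<n. X k j \<in> {0..1} \<Longrightarrow> \<forall>j<n. x j \<in> {0..1} \<Longrightarrow>
      \<forall>j<n. (\<lambda>k. X k j) \<longlonglongrightarrow> x j \<Longrightarrow> i < n \<Longrightarrow> (\<lambda>k. F (X k) i) \<longlonglongrightarrow> F x i"
  obtains x where "\<forall>j<n. x j \<in> {0..1}" "\<forall>i<n. F x i = x i"
proof -
  \<comment> \<open>The corner \<open>z\<close> of a Kuhn cell of mesh 1/(m+1). The vertices
    \<open>a\<close> and \<open>b\<close> may differ from one coordinate \<open>i\<close> to the
    next.\<close>
  have "\<exists>z. (\<forall>j. z j \<in> {0..1}) \<and>
      (\<forall>i. \<exists>a b. i < n \<longrightarrow> (\<forall>j<n. a j \<in> {0..1} \<and> \<bar>a j - z j\<bar> \<le> 1 / real (Suc m)) \<and>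
        (\<forall>j<n. b j \<in> {0..1} \<and> \<bar>b j - z j\<bar> \<le> 1 / real (Suc m)) \<and> a i \<le> F a i \<and> F b i \<le> b i)" for m
  proof -
    define p where "p = Suc m"
    define h where "h x = (\<lambda>j. real (x j) / real p)" for x :: "nat \<Rightarrow> nat"
    \<comment> \<open>Label 1 stands for "not pushed up", label 0 for "not pushed down". The labels
      forced on the faces, 0 at \<open>x i = 0\<close> and 1 at \<open>x i = p\<close>, are those
      that Kuhn's lemma demands, and they agree with this reading because F has values in
      [0,1].\<close>
    define label where "label x i =
      (if x i = p \<or> x i \<noteq> 0 \<and> F (h x) i < h x i then 1 else 0 :: nat)" for x i
    have p: "p > 0" by (simp add: p_def)
    have h01: "\<forall>j<n. h x j \<in> {0..1}" if "\<forall>j<n. x j \<le> p" for x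
      using that p by (auto simp: h_def)
    have lab1: "F (h x) i \<le> h x i" if "label x i = 1" "\<forall>j<n. x j \<le> p" "i < n" for x i
      using maps[OF h01[OF that(2)] that(3)] that(1) p
      by (auto simp: label_def h_def split: if_splits)
    have lab0: "h x i \<le> F (h x) i" if "label x i \<noteq> 1" "\<forall>j<n. x j \<le> p" "i < n" for x i
      using maps[OF h01[OF that(2)] that(3)] that(1) p
      by (auto simp: label_def h_def split: if_splits)
    obtain q where q: "\<forall>i<n. q i < p"
      and rs: "\<forall>i<n. \<exists>r s. (\<forall>j<n. q j \<le> r j \<and> r j \<le> q j + 1) \<and>
        (\<forall>j<n. q j \<le> s j \<and> s j \<le> q j + 1) \<and> label r i \<noteq> label s i"
      by (rule kuhn_lemma[of p n label]) (use p in \<open>auto simp: label_def\<close>)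
    \<comment> \<open>The value 0 beyond \<open>n\<close> puts all of \<open>z\<close> in the
      infinite product of unit intervals, where compactness is applied below.\<close>
    define z where "z j = (if j < n then h q j else 0)" for j
    have close: "\<forall>j<n. h r j \<in> {0..1} \<and> \<bar>h r j - z j\<bar> \<le> 1 / real (Suc m)"
      if "\<forall>j<n. q j \<le> r j \<and> r j \<le> q j + 1" for r
    proof (intro allI impI conjI)
      fix j assume j: "j < n"
      then have "r j \<le> p" "q j \<le> r j" "r j \<le> q j + 1" using that q
        by (auto simp: Suc_le_eq intro: le_less_trans dest!: spec[of _ j])
      then show "h r j \<in> {0..1}" "\<bar>h r j - z j\<bar> \<le> 1 / real (Suc m)"
        using j p by (auto simp: h_def z_def p_def[symmetric] diff_divide_distrib[symmetric]
            intro!: divide_right_mono)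
    qed
    have bound: "\<forall>j<n. r j \<le> p" if "\<forall>j<n. q j \<le> r j \<and> r j \<le> q j + 1" for r
      using that q by (metis Suc_eq_plus1 Suc_leI le_trans)
    have 1: "\<exists>a b. (\<forall>j<n. a j \<in> {0..1} \<and> \<bar>a j - z j\<bar> \<le> 1 / real (Suc m)) \<and>
        (\<forall>j<n. b j \<in> {0..1} \<and> \<bar>b j - z j\<bar> \<le> 1 / real (Suc m)) \<and> a i \<le> F a i \<and> F b i \<le> b i"
      if i: "i < n" for i
    proof -
      obtain r s where r: "\<forall>j<n. q j \<le> r j \<and> r j \<le> q j + 1"
        and s: "\<forall>j<n. q j \<le> s j \<and> s j \<le> q j + 1" and ne: "label r i \<noteq> label s i"
        using rs i by blast
      show ?thesis
      proof (cases "label r i = 1")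
        case True
        then show ?thesis
          using ne close[OF r] close[OF s] lab1[OF _ bound[OF r] i] lab0[OF _ bound[OF s] i] by metis
      next
        case False
        then have "label s i = 1" using ne by (auto simp: label_def split: if_splits)
        then show ?thesis
          using False close[OF r] close[OF s] lab1[OF _ bound[OF s] i] lab0[OF _ bound[OF r] i] by metis
      qed
    qed
    have 2: "z j \<in> {0..1}" for j
      using h01[of q] q by (auto simp: z_def less_imp_le)
    have 3: "\<exists>a b. i < n \<longrightarrow> (\<forall>j<n. a j \<in> {0..1} \<and> \<bar>a j - z j\<bar> \<le> 1 / real (Suc m)) \<and>
        (\<forall>j<n. b j \<in> {0..1} \<and> \<bar>b j - z j\<bar> \<le> 1 / real (Suc m)) \<and> a i \<le> F a i \<and> F b i \<le> b i" for i
      using 1[of i] by (cases "i < n") simp_all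
    show ?thesis by (rule exI[of _ z]) (intro conjI allI 2 3)
  qed
  then obtain Z where Z01: "\<And>m j. Z m j \<in> {0..1::real}"
    and "\<And>m. \<forall>i. \<exists>a b. i < n \<longrightarrow> (\<forall>j<n. a j \<in> {0..1} \<and> \<bar>a j - Z m j\<bar> \<le> 1 / real (Suc m)) \<and>
        (\<forall>j<n. b j \<in> {0..1} \<and> \<bar>b j - Z m j\<bar> \<le> 1 / real (Suc m)) \<and> a i \<le> F a i \<and> F b i \<le> b i"
    by metis
  then obtain A B where
    A: "\<And>m i j. i < n \<Longrightarrow> j < n \<Longrightarrow> A m i j \<in> {0..1} \<and> \<bar>A m i j - Z m j\<bar> \<le> 1 / real (Suc m)"
    and B: "\<And>m i j. i < n \<Longrightarrow> j < n \<Longrightarrow> B m i j \<in> {0..1} \<and> \<bar>B m i j - Z m j\<bar> \<le> 1 / real (Suc m)"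
    and AF: "\<And>m i. i < n \<Longrightarrow> A m i i \<le> F (A m i) i" and BF: "\<And>m i. i < n \<Longrightarrow> F (B m i) i \<le> B m i i"
    by metis
  \<comment> \<open>By Tychonoff the countable cube is compact, and being metrizable it is
    sequentially compact; convergence there is coordinatewise.\<close>
  have "compact (PiE UNIV (\<lambda>_::nat. {0..1::real}))"
    using compactin_PiE[of "\<lambda>_. euclidean" UNIV "\<lambda>_::nat. {0..1::real}"]
    by (simp add: euclidean_product_topology)
  then have "seq_compact (PiE UNIV (\<lambda>_::nat. {0..1::real}))"
    by (simp add: compact_eq_seq_compact_metric)
  then obtain x \<rho> where x: "x \<in> PiE UNIV (\<lambda>_. {0..1})" and \<rho>: "strict_mono \<rho>"
    and lim: "(Z \<circ> \<rho>) \<longlonglongrightarrow> x"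
    by (rule seq_compactE[where f = Z]) (use Z01 in auto)
  have x01: "\<forall>j<n. x j \<in> {0..1}" using x by (auto simp: PiE_iff)
  have limj: "(\<lambda>k. Z (\<rho> k) j) \<longlonglongrightarrow> x j" for j
    using continuous_on_tendsto_compose[OF continuous_on_product_coordinates[of j] lim]
    by (simp add: o_def)
  have inv0: "(\<lambda>k. 1 / real (Suc (\<rho> k))) \<longlonglongrightarrow> 0"
    using LIMSEQ_subseq_LIMSEQ[OF LIMSEQ_inverse_real_of_nat \<rho>] by (simp add: o_def inverse_eq_divide)
  have near: "Y \<longlonglongrightarrow> x j" if "\<And>k. \<bar>Y k - Z (\<rho> k) j\<bar> \<le> 1 / real (Suc (\<rho> k))" for Y j
  proof -
    have "(\<lambda>k. Y k - Z (\<rho> k) j) \<longlonglongrightarrow> 0"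
      by (rule Lim_null_comparison[OF _ inv0]) (use that in auto)
    from tendsto_add[OF this limj[of j]] show ?thesis by simp
  qed
  have "F x i = x i" if i: "i < n" for i
  proof (rule antisym)
    \<comment> \<open>The vertices of both kinds shrink to the same limit as the corners, so the two
      opposite inequalities meet at \<open>x\<close>.\<close>
    have a: "\<forall>j<n. (\<lambda>k. A (\<rho> k) i j) \<longlonglongrightarrow> x j" and b: "\<forall>j<n. (\<lambda>k. B (\<rho> k) i j) \<longlonglongrightarrow> x j"
      using A[OF i] B[OF i] by (auto intro!: near)
    have "(\<lambda>k. F (A (\<rho> k) i) i) \<longlonglongrightarrow> F x i" "(\<lambda>k. F (B (\<rho> k) i) i) \<longlonglongrightarrow> F x i"
      using A[OF i] B[OF i] x01 a b i by (auto intro!: cont)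
    then show "F x i \<le> x i" "x i \<le> F x i"
      using a b i AF[OF i] BF[OF i] by (auto intro: LIMSEQ_le)
  qed
  then show thesis using that x01 by blast
qed

section \<open>Schauder's theorem for functions with values in the unit interval\<close>

text \<open>Brouwer's theorem on interpolated node values gives functions that \<Phi> moves by at
  most e, for every e > 0, and equicontinuity of the images lets a subsequence converge uniformly to
  a true fixed point. Since that compactness supplies uniform convergence, continuity of \<Phi> is
  asked only as pointwise convergence of the images.\<close>

lemma schauder_unit_interval_functions:
  fixes \<Phi> :: "('a::euclidean_space \<Rightarrow> real) \<Rightarrow> 'a \<Rightarrow> real" and X :: "'a set"
  defines "C \<equiv> {w. continuous_on X w \<and> w ` X \<subseteq> {0..1}}"
  assumes X: "compact X"
    and maps: "\<And>w x. w \<in> C \<Longrightarrow> x \<in> X \<Longrightarrow> \<Phi> w x \<in> {0..1}"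
    and equicont: "\<And>e. e > 0 \<Longrightarrow> \<exists>d>0. \<forall>w\<in>C. \<forall>x\<in>X. \<forall>y\<in>X. dist x y < d \<longrightarrow> \<bar>\<Phi> w x - \<Phi> w y\<bar> < e"
    and cont: "\<And>W w x. (\<And>k. W k \<in> C) \<Longrightarrow> w \<in> C \<Longrightarrow> uniform_limit X W w sequentially \<Longrightarrow>
      x \<in> X \<Longrightarrow> (\<lambda>k. \<Phi> (W k) x) \<longlonglongrightarrow> \<Phi> w x"
  obtains w where "w \<in> C" "\<And>x. x \<in> X \<Longrightarrow> \<Phi> w x = w x"
proof -
  have approx: "\<exists>w\<in>C. \<forall>x\<in>X. \<bar>w x - \<Phi> w x\<bar> \<le> e" if e: "e > 0" for e
  proof -
    obtain d where d: "d > 0"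
      and osc: "\<And>w x y. w \<in> C \<Longrightarrow> x \<in> X \<Longrightarrow> y \<in> X \<Longrightarrow> dist x y < d \<Longrightarrow> \<bar>\<Phi> w x - \<Phi> w y\<bar> < e"
      using equicont[OF e] by blast
    obtain N where N: "finite N" "N \<subseteq> X" "X \<subseteq> (\<Union>c\<in>N. ball c d)"
      using seq_compact_imp_totally_bounded[of X] X d by (metis compact_eq_seq_compact_metric)
    obtain c and n :: nat where c: "N = c ` {..<n}"
      using finite_imp_nat_seg_image_inj_on[OF N(1)] by (auto simp: lessThan_def)
    \<comment> \<open>Interpolate values at the nodes \<open>c i\<close> by a partition of unity: a fixed point of the induced
      map on node values moves by at most the oscillation of \<open>\<Phi> w\<close> over distance \<open>d\<close>.\<close>
    define \<phi> where "\<phi> i x = max 0 (d - dist x (c i))" for i x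
    define S where "S x = (\<Sum>i<n. \<phi> i x)" for x
    define w where "w z x = (\<Sum>i<n. z i * \<phi> i x) / S x" for z x
    have \<phi>0: "\<phi> i x \<ge> 0" for i x by (simp add: \<phi>_def)
    have S0: "S x > 0" if x: "x \<in> X" for x
    proof -
      obtain i where "i < n" "dist x (c i) < d"
        using N(3) x c by (auto simp: dist_commute)
      then show ?thesis unfolding S_def
        by (intro sum_pos2[of _ i]) (auto simp: \<phi>_def)
    qed
    have cX: "c i \<in> X" if "i < n" for i using N(2) c that by auto
    have wC: "w z \<in> C" if z: "\<forall>j<n. z j \<in> {0..1}" for z
    proof -
      have "continuous_on X (w z)"
        unfolding w_def
        by (intro continuous_on_divide)
          (use S0 in \<open>fastforce simp: S_def \<phi>_def intro!: continuous_intros\<close>)+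
      moreover have "w z x \<in> {0..1}" if x: "x \<in> X" for x
      proof -
        have "(\<Sum>i<n. z i * \<phi> i x) \<ge> 0" "(\<Sum>i<n. z i * \<phi> i x) \<le> S x"
          unfolding S_def using z \<phi>0 by (auto intro!: sum_nonneg sum_mono mult_left_le_one_le)
        then show ?thesis using S0[OF x] by (auto simp: w_def)
      qed
      ultimately show ?thesis by (auto simp: C_def)
    qed
    \<comment> \<open>Each weight \<open>\<phi> j x / S x\<close> lies in [0,1], so the uniform
      distance of two interpolants is at most the l1 distance of their node values.\<close>
    have wlim: "uniform_limit X (\<lambda>k. w (Z k)) (w z) sequentially"
      if "\<forall>j<n. (\<lambda>k. Z k j) \<longlonglongrightarrow> z j" for Z z
    proof (rule uniform_limitI)
      fix \<epsilon> :: real assume \<epsilon>: "\<epsilon> > 0"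
      have "(\<lambda>k. \<Sum>j<n. \<bar>Z k j - z j\<bar>) \<longlonglongrightarrow> (\<Sum>j<n. \<bar>z j - z j\<bar>)"
        using that by (intro tendsto_intros) auto
      then have "\<forall>\<^sub>F k in sequentially. (\<Sum>j<n. \<bar>Z k j - z j\<bar>) < \<epsilon>"
        using \<epsilon> by (intro order_tendstoD) auto
      then show "\<forall>\<^sub>F k in sequentially. \<forall>x\<in>X. dist (w (Z k) x) (w z x) < \<epsilon>"
      proof eventually_elim
        case (elim k)
        show ?case
        proof
          fix x assume x: "x \<in> X"
          have "dist (w (Z k) x) (w z x) = \<bar>\<Sum>j<n. (Z k j - z j) * (\<phi> j x / S x)\<bar>"
            by (simp add: dist_real_def w_def diff_divide_distrib[symmetric] sum_subtractf[symmetric]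
                left_diff_distrib sum_divide_distrib)
          also have "\<dots> \<le> (\<Sum>j<n. \<bar>(Z k j - z j) * (\<phi> j x / S x)\<bar>)" by (rule sum_abs)
          also have "\<dots> \<le> (\<Sum>j<n. \<bar>Z k j - z j\<bar>)"
          proof (rule sum_mono)
            fix j assume "j \<in> {..<n}"
            then have "\<phi> j x \<le> S x" unfolding S_def using \<phi>0 by (intro member_le_sum) auto
            then show "\<bar>(Z k j - z j) * (\<phi> j x / S x)\<bar> \<le> \<bar>Z k j - z j\<bar>"
              using S0[OF x] \<phi>0[of j x] unfolding abs_mult by (intro mult_right_le_one_le) auto
          qed
          finally show "dist (w (Z k) x) (w z x) < \<epsilon>" using elim by simp
        qed
      qed
    qed
    obtain z where z: "\<forall>j<n. z j \<in> {0..1}" and fix_z: "\<forall>i<n. \<Phi> (w z) (c i) = z i"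
    proof (rule brouwer_unit_cube_nat[of n "\<lambda>z i. \<Phi> (w z) (c i)"])
      show "\<Phi> (w z) (c i) \<in> {0..1}" if "\<forall>j<n. z j \<in> {0..1}" "i < n" for z i
        using maps[OF wC cX] that by blast
      show "(\<lambda>k. \<Phi> (w (Z k)) (c i)) \<longlonglongrightarrow> \<Phi> (w z) (c i)"
        if "\<forall>k. \<forall>j<n. Z k j \<in> {0..1}" "\<forall>j<n. z j \<in> {0..1}"
          "\<forall>j<n. (\<lambda>k. Z k j) \<longlonglongrightarrow> z j" "i < n" for Z z i
        by (rule cont[OF wC wC wlim cX]) (use that in auto)
    qed (use that in blast)
    have "\<bar>w z x - \<Phi> (w z) x\<bar> \<le> e" if x: "x \<in> X" for x
    proof -
      \<comment> \<open>The weights sum to 1, so the error is a weighted mean of differences between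
        values of \<open>\<Phi> (w z)\<close> at nodes and at \<open>x\<close>; nodes at distance
        \<open>d\<close> or more have weight 0.\<close>
      have "w z x - \<Phi> (w z) x = (\<Sum>i<n. (z i - \<Phi> (w z) x) * \<phi> i x) / S x"
        using S0[OF x] by (simp add: w_def left_diff_distrib sum_subtractf diff_divide_distrib
            sum_distrib_left[symmetric] S_def[symmetric])
      also have "\<bar>\<dots>\<bar> \<le> (\<Sum>i<n. e * \<phi> i x) / S x"
      proof -
        have "\<bar>(z i - \<Phi> (w z) x) * \<phi> i x\<bar> \<le> e * \<phi> i x" if i: "i < n" for i
        proof (cases "dist x (c i) < d")
          case True
          then have "\<bar>z i - \<Phi> (w z) x\<bar> \<le> e"
            using osc[OF wC[OF z] cX[OF i] x] fix_z i by (force simp: dist_commute)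
          then show ?thesis using \<phi>0[of i x] by (simp add: abs_mult mult_right_mono)
        qed (simp add: \<phi>_def)
        then have "\<bar>\<Sum>i<n. (z i - \<Phi> (w z) x) * \<phi> i x\<bar> \<le> (\<Sum>i<n. e * \<phi> i x)"
          by (intro order_trans[OF sum_abs] sum_mono) auto
        then show ?thesis using S0[OF x] by (simp add: divide_right_mono)
      qed
      also have "\<dots> = e" using S0[OF x] by (simp add: sum_distrib_left[symmetric] S_def[symmetric])
      finally show ?thesis .
    qed
    then show ?thesis using wC[OF z] by blast
  qed
  have "\<exists>w. w \<in> C \<and> (\<forall>x\<in>X. \<bar>w x - \<Phi> w x\<bar> \<le> inverse (real (Suc m)))" for m
    using approx[of "inverse (real (Suc m))"] by auto
  then obtain W where WC: "\<And>m. W m \<in> C"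
    and W: "\<And>m x. x \<in> X \<Longrightarrow> \<bar>W m x - \<Phi> (W m) x\<bar> \<le> inverse (real (Suc m))"
    by metis
  \<comment> \<open>Arzela-Ascoli is applied to the images \<open>\<Phi> (W m)\<close>, since
    equicontinuity is known for them; the \<open>W m\<close> follow along the same subsequence
    because they differ from their images by a uniform null sequence.\<close>
  obtain g \<rho> where g: "continuous_on X g" and \<rho>: "strict_mono (\<rho> :: nat \<Rightarrow> nat)"
    and lim: "\<And>e. 0 < e \<Longrightarrow> \<exists>M. \<forall>n x. n \<ge> M \<and> x \<in> X \<longrightarrow> norm (\<Phi> (W (\<rho> n)) x - g x) < e"
  proof (rule Arzela_Ascoli[OF X, of "\<lambda>m. \<Phi> (W m)" 1])
    show "norm (\<Phi> (W m) x) \<le> 1" if "x \<in> X" for m x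
      using maps[OF WC that, of m] by auto
    show "\<exists>d>0. \<forall>n y. y \<in> X \<and> norm (x - y) < d \<longrightarrow> norm (\<Phi> (W n) x - \<Phi> (W n) y) < e"
      if "x \<in> X" "e > 0" for x e
      using equicont[OF that(2)] WC that(1) unfolding dist_norm real_norm_def by meson
  qed (use that in blast)
  have ul\<Phi>: "uniform_limit X (\<lambda>k. \<Phi> (W (\<rho> k))) g sequentially"
    unfolding uniform_limit_sequentially_iff using lim by (metis dist_norm)
  have "uniform_limit X (\<lambda>k x. W (\<rho> k) x - \<Phi> (W (\<rho> k)) x) (\<lambda>_. 0) sequentially"
  proof (rule uniform_limitI)
    fix e :: real assume "e > 0"
    moreover have "(\<lambda>k. inverse (real (Suc (\<rho> k)))) \<longlonglongrightarrow> 0"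
      using LIMSEQ_subseq_LIMSEQ[OF LIMSEQ_inverse_real_of_nat \<rho>] by (simp add: o_def)
    ultimately have "\<forall>\<^sub>F k in sequentially. inverse (real (Suc (\<rho> k))) < e"
      by (intro order_tendstoD)
    then show "\<forall>\<^sub>F k in sequentially. \<forall>x\<in>X. dist (W (\<rho> k) x - \<Phi> (W (\<rho> k)) x) 0 < e"
      by eventually_elim (use W in \<open>fastforce intro: le_less_trans\<close>)
  qed
  from uniform_limit_add[OF this ul\<Phi>] have ulW: "uniform_limit X (\<lambda>k. W (\<rho> k)) g sequentially"
    by simp
  have gC: "g \<in> C"
  proof -
    have "g x \<in> {0..1}" if "x \<in> X" for x
      by (rule closed_sequentially[OF closed_atLeastAtMost _ tendsto_uniform_limitI[OF ulW that]])
        (use WC that in \<open>auto simp: C_def image_subset_iff\<close>)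
    then show ?thesis using g by (auto simp: C_def)
  qed
  have "\<Phi> g x = g x" if "x \<in> X" for x
    using cont[of "\<lambda>k. W (\<rho> k)", OF WC gC ulW that] tendsto_uniform_limitI[OF ul\<Phi> that]
    by (rule LIMSEQ_unique)
  then show thesis using that gC by blast
qed

section \<open>Integral operators with kernel c - max(t,s)\<close>

text \<open>One operator serves both equations: \<open>c = 2\<close> gives the kernel
  \<open>k1\<close> and \<open>c = 1/2\<close> gives \<open>k2\<close>.\<close>

definition kernel_op :: "real \<Rightarrow> (real \<Rightarrow> real) \<Rightarrow> real \<Rightarrow> real" where
  "kernel_op c h t = (LINT s:{0..1}|lebesgue. (c - max t s) * h s)"

lemma kernel_integrable:
  fixes h :: "real \<Rightarrow> real"
  assumes "continuous_on {0..1} h"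
  shows "set_integrable lebesgue {0..1} (\<lambda>s. (c - max t s) * h s)"
  by (intro absolutely_integrable_continuous_real continuous_intros assms)

text \<open>Only the term -max(t,s) depends on t, so the sign of the kernel is irrelevant; this
  matters for \<open>k2\<close>, which changes sign.\<close>

lemma kernel_op_antimono:
  assumes "continuous_on {0..1} h" "\<And>s. s \<in> {0..1} \<Longrightarrow> 0 \<le> h s" "t \<le> t'"
  shows "kernel_op c h t' \<le> kernel_op c h t"
  unfolding kernel_op_def
  by (intro set_integral_mono kernel_integrable assms mult_right_mono) (use assms in auto)

text \<open>In the difference \<open>c\<close> cancels, and max is 1-Lipschitz in t on an interval
  of length 1. The constant depends on \<open>h\<close> through its bound alone, which yields
  equicontinuity over a whole family of integrands.\<close>

lemma kernel_op_lipschitz: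
  assumes h: "continuous_on {0..1} h" and M: "\<And>s. s \<in> {0..1} \<Longrightarrow> \<bar>h s\<bar> \<le> M"
  shows "\<bar>kernel_op c h t - kernel_op c h t'\<bar> \<le> M * \<bar>t - t'\<bar>"
proof -
  let ?d = "\<lambda>s. (max t' s - max t s) * h s"
  have int: "set_integrable lebesgue {0..1} ?d"
    by (intro absolutely_integrable_continuous_real continuous_intros h)
  have "kernel_op c h t - kernel_op c h t' =
      (LINT s:{0..1}|lebesgue. (c - max t s) * h s - (c - max t' s) * h s)"
    unfolding kernel_op_def by (intro set_integral_diff(2)[symmetric] kernel_integrable h)
  also have "(\<lambda>s. (c - max t s) * h s - (c - max t' s) * h s) = ?d"
    by (simp add: algebra_simps)
  also have "\<bar>LINT s:{0..1}|lebesgue. ?d s\<bar> \<le> (LINT s:{0..1}|lebesgue. \<bar>?d s\<bar>)"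
    using set_integral_norm_bound[OF int] by simp
  also have "\<dots> \<le> (LINT s:{0..1::real}|lebesgue. M * \<bar>t - t'\<bar>)"
  proof (rule set_integral_mono)
    show "set_integrable lebesgue {0..1} (\<lambda>s. \<bar>?d s\<bar>)" by (intro set_integrable_abs int)
    show "set_integrable lebesgue {0..1::real} (\<lambda>_. M * \<bar>t - t'\<bar>)"
      by (intro absolutely_integrable_continuous_real continuous_intros)
    show "\<bar>?d s\<bar> \<le> M * \<bar>t - t'\<bar>" if "s \<in> {0..1}" for s
      using mult_mono[of "\<bar>max t' s - max t s\<bar>" "\<bar>t - t'\<bar>" "\<bar>h s\<bar>" M] M[OF that]
      by (auto simp: abs_mult mult.commute)
  qed
  also have "\<dots> = M * \<bar>t - t'\<bar>" by (simp add: set_lebesgue_integral_def)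
  finally show ?thesis .
qed

text \<open>Dominated convergence; this is the source of the continuity of the Hammerstein
  map.\<close>

lemma kernel_op_tendsto:
  assumes h: "\<And>n. continuous_on {0..1} (h n)" and g: "continuous_on {0..1} g"
    and lim: "\<And>s. s \<in> {0..1} \<Longrightarrow> (\<lambda>n. h n s) \<longlonglongrightarrow> g s"
    and M: "\<And>n s. s \<in> {0..1} \<Longrightarrow> \<bar>h n s\<bar> \<le> M"
  shows "(\<lambda>n. kernel_op c (h n) t) \<longlonglongrightarrow> kernel_op c g t"
  unfolding kernel_op_def set_lebesgue_integral_def
proof (rule integral_dominated_convergence[where w = "\<lambda>s. indicator {0..1} s *\<^sub>R (\<bar>c - max t s\<bar> * M)"])
  show "integrable lebesgue (\<lambda>s::real. indicator {0..1} s *\<^sub>R (\<bar>c - max t s\<bar> * M))"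
    unfolding set_integrable_def[symmetric]
    by (intro absolutely_integrable_continuous_real continuous_intros)
  show "(\<lambda>s. indicator {0..1} s *\<^sub>R ((c - max t s) * g s)) \<in> borel_measurable lebesgue"
    using kernel_integrable[OF g, of c t] unfolding set_integrable_def by blast
  show "(\<lambda>s. indicator {0..1} s *\<^sub>R ((c - max t s) * h n s)) \<in> borel_measurable lebesgue" for n
    using kernel_integrable[OF h, of c t] unfolding set_integrable_def by blast
  show "AE s in lebesgue. (\<lambda>n. indicator {0..1} s *\<^sub>R ((c - max t s) * h n s))
      \<longlonglongrightarrow> indicator {0..1} s *\<^sub>R ((c - max t s) * g s)"
    by (intro AE_I2) (auto simp: indicator_def intro!: tendsto_intros lim)
  show "AE s in lebesgue. norm (indicator {0..1} s *\<^sub>R ((c - max t s) * h n s))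
      \<le> indicator {0..1} s *\<^sub>R (\<bar>c - max t s\<bar> * M)" for n
    by (intro AE_I2) (auto simp: indicator_def abs_mult intro!: mult_left_mono M)
qed

text \<open>The cone condition for the first component.\<close>

lemma kernel_op_2_ge:
  assumes h: "continuous_on {0..1} h" "\<And>s. s \<in> {0..1} \<Longrightarrow> 0 \<le> h s" and t: "t \<in> {0..1}"
  shows "(1 - t / 2) * kernel_op 2 h 0 \<le> kernel_op 2 h t"
proof -
  have "(1 - t / 2) * kernel_op 2 h 0 = (LINT s:{0..1}|lebesgue. (1 - t / 2) * ((2 - max 0 s) * h s))"
    unfolding kernel_op_def by simp
  also have "\<dots> \<le> kernel_op 2 h t"
    unfolding kernel_op_def
  proof (intro set_integral_mono kernel_integrable set_integrable_mult_right h(1))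
    fix s :: real assume s: "s \<in> {0..1}"
    \<comment> \<open>For s at most t the right side is 2 - t = (1 - t/2) * 2; for s > t both sides
      contain the factor 2 - s, and 1 - t/2 is at most 1.\<close>
    have "(1 - t / 2) * (2 - max 0 s) \<le> 2 - max t s"
    proof (cases "s \<le> t")
      case True
      have "(1 - t / 2) * (2 - s) \<le> (1 - t / 2) * 2" using s t by (intro mult_left_mono) auto
      then show ?thesis using True s t by (simp add: max_def)
    next
      case False
      have "(1 - t / 2) * (2 - s) \<le> 1 * (2 - s)" using s t by (intro mult_right_mono) auto
      then show ?thesis using False s t by (simp add: max_def)
    qed
    from mult_right_mono[OF this h(2)[OF s]]
    show "(1 - t / 2) * ((2 - max 0 s) * h s) \<le> (2 - max t s) * h s" by (simp add: mult.assoc)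
  qed
  finally show ?thesis .
qed

section \<open>An eigenpair of prescribed norms as a fixed point\<close>

text \<open>Rescaling is possible once the norms of both components are bounded below on all
  admissible pairs. For the first the value at 0 is bounded; the second may change sign, so its drop
  from 0 to 1 is bounded instead. The parameter \<sigma> fixes the sign of the second eigenvalue,
  and the values at 0 and 1 in the conclusion carry the two norms.\<close>

lemma hammerstein_eigenpair:
  fixes f g :: "real \<times> real \<times> real \<Rightarrow> real" and a b r c\<^sub>f c\<^sub>g \<sigma> :: real
  defines "D \<equiv> {0..1} \<times> {a/2..a} \<times> {-b..b}"
  assumes a: "a > 0" and b: "b > 0" and \<sigma>: "\<bar>\<sigma>\<bar> = 1"
    and f: "continuous_on D f" "\<And>p. p \<in> D \<Longrightarrow> f p \<ge> 0"
    and g: "continuous_on D g" "\<And>p. p \<in> D \<Longrightarrow> g p \<ge> 0"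
    and cf: "c\<^sub>f > 0" "\<And>u v. continuous_on {0..1} u \<Longrightarrow> continuous_on {0..1} v \<Longrightarrow>
      (\<And>s. s \<in> {0..1} \<Longrightarrow> (s, u s, v s) \<in> D) \<Longrightarrow> c\<^sub>f \<le> kernel_op 2 (\<lambda>s. f (s, u s, v s)) 0"
    and cg: "c\<^sub>g > 0" "\<And>u v. continuous_on {0..1} u \<Longrightarrow> continuous_on {0..1} v \<Longrightarrow>
      (\<And>s. s \<in> {0..1} \<Longrightarrow> (s, u s, v s) \<in> D) \<Longrightarrow>
      c\<^sub>g \<le> kernel_op (1/2) (\<lambda>s. g (s, u s, v s)) 0 - kernel_op (1/2) (\<lambda>s. g (s, u s, v s)) 1"
  obtains \<alpha> \<beta> u v where "\<alpha> > 0" "\<beta> > 0" "continuous_on {0..1} u" "continuous_on {0..1} v"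
    "\<And>s. s \<in> {0..1} \<Longrightarrow> (s, u s, v s) \<in> D" "u 0 = a" "max \<bar>v 0\<bar> \<bar>v 1\<bar> = b"
    "\<And>t. t \<in> {0..1} \<Longrightarrow> u t = \<alpha> * kernel_op 2 (\<lambda>s. f (s, u s, v s)) t"
    "\<And>t. t \<in> {0..1} \<Longrightarrow> v t = \<sigma> * \<beta> * kernel_op (1/2) (\<lambda>s. g (s, u s, v s)) t"
proof -
  \<comment> \<open>A pair of functions is encoded as one function on two copies of the interval, normalised to
    values in \<open>{0..1}\<close>.\<close>
  define X where "X = {0..1::real} \<times> {0, 1::real}"
  define C where "C = {w. continuous_on X w \<and> w ` X \<subseteq> {0..1::real}}"
  define U where "U w t = a / 2 * (1 + w (t, 0))" for w :: "real \<times> real \<Rightarrow> real" and t :: real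
  define V where "V w t = b * (2 * w (t, 1) - 1)" for w :: "real \<times> real \<Rightarrow> real" and t :: real
  define fw where "fw w s = f (s, U w s, V w s)" for w s
  define gw where "gw w s = g (s, U w s, V w s)" for w s
  define P where "P w t = kernel_op 2 (fw w) t" for w t
  define Q where "Q w t = kernel_op (1/2) (gw w) t" for w t
  define N where "N w = max \<bar>Q w 0\<bar> \<bar>Q w 1\<bar>" for w
  \<comment> \<open>The two branches solve \<open>U = a * P / P(0)\<close> and
    \<open>V = \<sigma> * b * Q / N\<close> for the encoded function, by inverting the affine maps
    in \<open>U\<close> and \<open>V\<close>; \<open>a\<close> and \<open>b\<close> cancel.\<close>
  define \<Phi> where "\<Phi> w x = (if snd x = 0 then 2 * P w (fst x) / P w 0 - 1
    else (\<sigma> * Q w (fst x) / N w + 1) / 2)" for w and x :: "real \<times> real"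
  have X: "compact X" unfolding X_def by (intro compact_Times) auto
  have "compact D" unfolding D_def by (intro compact_Times) auto
  then obtain M\<^sub>f M\<^sub>g where Mf: "\<And>p. p \<in> D \<Longrightarrow> \<bar>f p\<bar> \<le> M\<^sub>f" and Mg: "\<And>p. p \<in> D \<Longrightarrow> \<bar>g p\<bar> \<le> M\<^sub>g"
    using compact_imp_bounded[OF compact_continuous_image[OF f(1)]]
      compact_imp_bounded[OF compact_continuous_image[OF g(1)]]
    unfolding bounded_iff by (metis imageI real_norm_def)
  have wX: "w (t, 0) \<in> {0..1}" "w (t, 1) \<in> {0..1}" if "w \<in> C" "t \<in> {0..1}" for w t
    using that by (auto simp: C_def X_def image_subset_iff)
  have UVD: "(t, U w t, V w t) \<in> D" if w: "w \<in> C" and t: "t \<in> {0..1}" for w t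
  proof -
    have "a / 2 * (1 + 0) \<le> U w t" "U w t \<le> a / 2 * (1 + 1)"
      unfolding U_def using wX[OF w t] a by (auto intro!: mult_left_mono)
    moreover have "b * (2 * 0 - 1) \<le> V w t" "V w t \<le> b * (2 * 1 - 1)"
      unfolding V_def using wX[OF w t] b by (intro mult_left_mono; simp)+
    ultimately show ?thesis using t by (auto simp: D_def)
  qed
  have slice: "continuous_on {0..1} (\<lambda>t. w (t, i))" if "w \<in> C" "i \<in> {0, 1}" for w i
  proof (rule continuous_on_compose2[of X w])
    show "continuous_on {0..1} (\<lambda>t. (t, i))" by (intro continuous_intros)
  qed (use that in \<open>auto simp: C_def X_def\<close>)
  have Uc: "continuous_on {0..1} (U w)" and Vc: "continuous_on {0..1} (V w)" if "w \<in> C" for w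
    unfolding U_def V_def by (intro continuous_intros slice that; simp)+
  have fwc: "continuous_on {0..1} (fw w)" and gwc: "continuous_on {0..1} (gw w)" if w: "w \<in> C" for w
    unfolding fw_def gw_def using UVD[OF w]
    by (intro continuous_on_compose2[OF f(1)] continuous_on_compose2[OF g(1)] continuous_on_Pair
        continuous_on_id Uc[OF w] Vc[OF w]; blast)+
  have fw0: "0 \<le> fw w s" "\<bar>fw w s\<bar> \<le> M\<^sub>f" and gw0: "0 \<le> gw w s" "\<bar>gw w s\<bar> \<le> M\<^sub>g"
    if "w \<in> C" "s \<in> {0..1}" for w s
    unfolding fw_def gw_def using f(2) g(2) Mf Mg UVD[OF that] by auto
  have P0: "c\<^sub>f \<le> P w 0" if "w \<in> C" for w
    unfolding P_def fw_def using cf(2)[OF Uc Vc UVD] that by blast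
  \<comment> \<open>The drop is at most |Q(0)| + |Q(1)|, hence at most twice
    \<open>N w\<close>.\<close>
  have N0: "c\<^sub>g / 2 \<le> N w" if "w \<in> C" for w
  proof -
    have "c\<^sub>g \<le> Q w 0 - Q w 1"
      unfolding Q_def gw_def using cg(2)[OF Uc Vc UVD] that by blast
    then show ?thesis unfolding N_def by linarith
  qed
  have Pdec: "P w t' \<le> P w t" and Qdec: "Q w t' \<le> Q w t" if "w \<in> C" "t \<le> t'" for w t t'
    unfolding P_def Q_def using that fw0 gw0 by (auto intro!: kernel_op_antimono fwc gwc)
  \<comment> \<open>On [0,1] the cone factor 1 - t/2 is at least 1/2. This is why the first
    component may be confined to \<open>{a/2..a}\<close>, and why 2 P(t)/P(0) - 1 is
    nonnegative.\<close>
  have Phalf: "P w t \<ge> P w 0 / 2" if w: "w \<in> C" and t: "t \<in> {0..1}" for w t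
  proof -
    have "1/2 * P w 0 \<le> (1 - t/2) * P w 0"
      using t P0[OF w] cf(1) by (intro mult_right_mono) auto
    also have "\<dots> \<le> P w t"
      unfolding P_def by (intro kernel_op_2_ge fwc fw0 w t)
    finally show ?thesis by simp
  qed
  have QN: "\<bar>Q w t\<bar> \<le> N w" if w: "w \<in> C" and t: "t \<in> {0..1}" for w t
    using Qdec[OF w, of 0 t] Qdec[OF w, of t 1] t unfolding N_def by auto
  have lims: "(\<lambda>k. P (W k) t) \<longlonglongrightarrow> P w t" "(\<lambda>k. Q (W k) t) \<longlonglongrightarrow> Q w t"
    if W: "\<And>k. W k \<in> C" and w: "w \<in> C" and ul: "uniform_limit X W w sequentially" for W w t
  proof -
    have UV: "(\<lambda>k. (s, U (W k) s, V (W k) s)) \<longlonglongrightarrow> (s, U w s, V w s)" if "s \<in> {0..1}" for s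
      unfolding U_def V_def using that
      by (intro tendsto_intros tendsto_uniform_limitI[OF ul]) (auto simp: X_def)
    have f_lim: "(\<lambda>k. fw (W k) s) \<longlonglongrightarrow> fw w s" and g_lim: "(\<lambda>k. gw (W k) s) \<longlonglongrightarrow> gw w s"
      if "s \<in> {0..1}" for s
      unfolding fw_def gw_def using continuous_on_tendsto_compose[OF f(1) UV[OF that]]
        continuous_on_tendsto_compose[OF g(1) UV[OF that]] UVD[OF W that] UVD[OF w that] by auto
    show "(\<lambda>k. P (W k) t) \<longlonglongrightarrow> P w t"
      unfolding P_def by (rule kernel_op_tendsto[OF fwc[OF W] fwc[OF w] f_lim fw0(2)[OF W]])
    show "(\<lambda>k. Q (W k) t) \<longlonglongrightarrow> Q w t"
      unfolding Q_def by (rule kernel_op_tendsto[OF gwc[OF W] gwc[OF w] g_lim gw0(2)[OF W]])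
  qed
  obtain w where w: "w \<in> C" and fixw: "\<And>x. x \<in> X \<Longrightarrow> \<Phi> w x = w x"
  proof (rule schauder_unit_interval_functions[OF X, of \<Phi>, folded C_def])
    show "\<Phi> w x \<in> {0..1}" if w: "w \<in> C" and x: "x \<in> X" for w x
    proof (cases "snd x = 0")
      case True
      have t: "fst x \<in> {0..1}" using x by (auto simp: X_def)
      have "P w (fst x) \<le> P w 0" using Pdec[OF w] t by auto
      then show ?thesis using True Phalf[OF w t] P0[OF w] cf(1) by (auto simp: \<Phi>_def field_simps)
    next
      case False
      have t: "fst x \<in> {0..1}" using x by (auto simp: X_def)
      have "\<bar>\<sigma> * Q w (fst x) / N w\<bar> \<le> 1"
        using QN[OF w t] N0[OF w] cg(1) \<sigma> by (auto simp: abs_mult)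
      then have "-1 \<le> \<sigma> * Q w (fst x) / N w" "\<sigma> * Q w (fst x) / N w \<le> 1" by linarith+
      then show ?thesis using False by (simp add: \<Phi>_def)
    qed
    show "\<exists>d>0. \<forall>w\<in>C. \<forall>x\<in>X. \<forall>y\<in>X. dist x y < d \<longrightarrow> \<bar>\<Phi> w x - \<Phi> w y\<bar> < e" if e: "e > 0" for e
    proof -
      \<comment> \<open>A common Lipschitz constant on both copies: the numerators bound the slopes
        of \<open>P\<close> and \<open>Q\<close>, the denominators come from
        \<open>P(0) \<ge> c\<^sub>f\<close> and \<open>2 * N \<ge> c\<^sub>g\<close>, and the
        summand 1 makes \<open>L\<close> positive.\<close>
      define L where "L = 2 * \<bar>M\<^sub>f\<bar> / c\<^sub>f + \<bar>M\<^sub>g\<bar> / c\<^sub>g + 1"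
      have L: "2 * \<bar>M\<^sub>f\<bar> / c\<^sub>f \<le> L" "\<bar>M\<^sub>g\<bar> / c\<^sub>g \<le> L" "L > 0"
        unfolding L_def using cf(1) cg(1) by (auto intro!: add_nonneg_pos add_nonneg_nonneg)
      have "\<bar>\<Phi> w x - \<Phi> w y\<bar> < e"
        if w: "w \<in> C" and x: "x \<in> X" and y: "y \<in> X" and d: "dist x y < min 1 (e / L)" for w x y
      proof -
        let ?\<delta> = "\<bar>fst x - fst y\<bar>"
        have "?\<delta> \<le> dist x y" "\<bar>snd x - snd y\<bar> \<le> dist x y"
          using dist_fst_le[of x y] dist_snd_le[of x y] by (simp_all add: dist_real_def)
        with d have \<delta>: "?\<delta> < e / L" and "\<bar>snd x - snd y\<bar> < 1" by auto
        \<comment> \<open>The two copies of the interval lie at distance 1, so the 1 in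
          \<open>min 1 (e / L)\<close> keeps both points on one copy.\<close>
        then have s: "snd x = snd y" using x y by (auto simp: X_def)
        have "\<bar>\<Phi> w x - \<Phi> w y\<bar> \<le> L * ?\<delta>"
        proof (cases "snd x = 0")
          case True
          have "\<Phi> w x - \<Phi> w y = 2 * (P w (fst x) - P w (fst y)) / P w 0"
            using True s by (simp add: \<Phi>_def diff_divide_distrib right_diff_distrib)
          then have "\<bar>\<Phi> w x - \<Phi> w y\<bar> = 2 * \<bar>P w (fst x) - P w (fst y)\<bar> / P w 0"
            using P0[OF w] cf(1) by (simp only: abs_mult abs_divide)
          also have "\<dots> \<le> 2 * (\<bar>M\<^sub>f\<bar> * ?\<delta>) / c\<^sub>f"
            unfolding P_def[of w "fst x"] P_def[of w "fst y"] using P0[OF w] cf(1) fw0(2)[OF w]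
            by (intro frac_le mult_left_mono kernel_op_lipschitz fwc[OF w]) force+
          also have "\<dots> = (2 * \<bar>M\<^sub>f\<bar> / c\<^sub>f) * ?\<delta>" by simp
          also have "\<dots> \<le> L * ?\<delta>" using L by (intro mult_right_mono) auto
          finally show ?thesis .
        next
          case False
          have "\<Phi> w x - \<Phi> w y = \<sigma> * (Q w (fst x) - Q w (fst y)) / (2 * N w)"
            using False s by (simp add: \<Phi>_def diff_divide_distrib right_diff_distrib add_divide_distrib)
          then have "\<bar>\<Phi> w x - \<Phi> w y\<bar> = \<bar>Q w (fst x) - Q w (fst y)\<bar> / (2 * N w)"
            using N0[OF w] cg(1) \<sigma> by (simp add: abs_mult)
          also have "\<dots> \<le> (\<bar>M\<^sub>g\<bar> * ?\<delta>) / c\<^sub>g"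
            unfolding Q_def[of w "fst x"] Q_def[of w "fst y"] using N0[OF w] cg(1) gw0(2)[OF w]
            by (intro frac_le kernel_op_lipschitz gwc[OF w]) force+
          also have "\<dots> = (\<bar>M\<^sub>g\<bar> / c\<^sub>g) * ?\<delta>" by simp
          also have "\<dots> \<le> L * ?\<delta>" using L by (intro mult_right_mono) auto
          finally show ?thesis .
        qed
        also have "\<dots> < e" using \<delta> L(3) by (simp add: field_simps)
        finally show ?thesis .
      qed
      then show ?thesis using e L(3) by (intro exI[of _ "min 1 (e / L)"]) auto
    qed
    show "(\<lambda>k. \<Phi> (W k) x) \<longlonglongrightarrow> \<Phi> w x"
      if "\<And>k. W k \<in> C" "w \<in> C" "uniform_limit X W w sequentially" for W w x
    proof -
      note lims = lims[OF that]
      have N: "(\<lambda>k. N (W k)) \<longlonglongrightarrow> N w"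
        unfolding N_def by (intro tendsto_intros lims)
      have "P w 0 \<noteq> 0" "N w \<noteq> 0" using P0[OF that(2)] N0[OF that(2)] cf(1) cg(1) by auto
      then show ?thesis unfolding \<Phi>_def
        by (cases "snd x = 0") (auto intro!: tendsto_intros lims N)
    qed
  qed (use that in blast)
  \<comment> \<open>Undoing the encoding at the fixed point reveals the eigenvalues a/P(0) and
    \<sigma> b/N.\<close>
  have Ueq: "U w t = a / P w 0 * P w t" and Veq: "V w t = \<sigma> * (b / N w) * Q w t" if t: "t \<in> {0..1}" for t
  proof -
    have "w (t, 0) = 2 * P w t / P w 0 - 1" "2 * w (t, 1) - 1 = \<sigma> * Q w t / N w"
      using fixw[of "(t, 0)"] fixw[of "(t, 1)"] t by (auto simp: \<Phi>_def X_def)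
    then show "U w t = a / P w 0 * P w t" "V w t = \<sigma> * (b / N w) * Q w t"
      by (simp_all add: U_def V_def)
  qed
  have Npos: "N w > 0" and Ppos: "P w 0 > 0" using N0[OF w] P0[OF w] cf(1) cg(1) by auto
  have "\<bar>V w t\<bar> = b / N w * \<bar>Q w t\<bar>" if "t \<in> {0..1}" for t
    using Veq[OF that] \<sigma> b Npos by (simp add: abs_mult)
  then have "max \<bar>V w 0\<bar> \<bar>V w 1\<bar> = b / N w * N w"
    using b Npos unfolding N_def by (simp add: max_mult_distrib_left)
  then have "max \<bar>V w 0\<bar> \<bar>V w 1\<bar> = b" using Npos by simp
  show thesis
  proof (rule that[OF _ _ Uc[OF w] Vc[OF w] UVD[OF w]])
    show "a / P w 0 > 0" "b / N w > 0" "U w 0 = a" using a b Ppos Npos Ueq[of 0] by simp_all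
    show "U w t = a / P w 0 * kernel_op 2 (\<lambda>s. f (s, U w s, V w s)) t"
      "V w t = \<sigma> * (b / N w) * kernel_op (1/2) (\<lambda>s. g (s, U w s, V w s)) t" if "t \<in> {0..1}" for t
      using Ueq[OF that] Veq[OF that] unfolding P_def[of w t] Q_def[of w t] fw_def gw_def .
    show "max \<bar>V w 0\<bar> \<bar>V w 1\<bar> = b" by fact
  qed
qed

section \<open>From the bounds on f and g to the two eigenpairs\<close>

text \<open>The weight 1 - s vanishes only at s = 1, a null set, so it cannot annihilate a
  nonnegative function of positive integral. It arises as \<open>k2 0 s - k2 1 s\<close>, the kernel
  of the drop of the second component.\<close>

lemma weighted_integral_pos:
  fixes g :: "real \<Rightarrow> real"
  assumes g0: "\<And>s. s \<in> {0..1} \<Longrightarrow> 0 \<le> g s" and pos: "(LINT s:{0..1}|lebesgue. g s) > 0"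
  shows "set_integrable lebesgue {0..1} (\<lambda>s. (1 - s) * g s)"
    and "(LINT s:{0..1}|lebesgue. (1 - s) * g s) > 0"
proof -
  let ?g = "\<lambda>s. indicator {0..1} s *\<^sub>R g s"
  let ?h = "\<lambda>s. indicator {0..1} s *\<^sub>R ((1 - s) * g s)"
  have h_eq: "?h = (\<lambda>s. (1 - s) * ?g s)" by (auto simp: indicator_def)
  \<comment> \<open>The Bochner integral of a non-integrable function is 0 by convention, so a
    positive integral entails integrability.\<close>
  have ig: "integrable lebesgue ?g"
    using pos not_integrable_integral_eq unfolding set_lebesgue_integral_def by fastforce
  have id: "(\<lambda>s::real. 1 - s) \<in> borel_measurable lebesgue"
    by (intro measurable_completion) simp
  have ih: "integrable lebesgue ?h"
  proof (rule Bochner_Integration.integrable_bound[OF ig])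
    show "?h \<in> borel_measurable lebesgue"
      unfolding h_eq by (intro borel_measurable_times id borel_measurable_integrable[OF ig])
    show "AE s in lebesgue. norm (?h s) \<le> norm (?g s)"
      by (intro AE_I2) (auto simp: indicator_def abs_mult intro!: mult_left_le_one_le)
  qed
  then show "set_integrable lebesgue {0..1} (\<lambda>s. (1 - s) * g s)" by (simp add: set_integrable_def)
  have h0: "?h s \<ge> 0" for s using g0 by (auto simp: indicator_def)
  have "integral\<^sup>L lebesgue ?h \<noteq> 0"
  proof
    assume "integral\<^sup>L lebesgue ?h = 0"
    then have "AE s in lebesgue. ?h s = 0"
      using integral_nonneg_eq_0_iff_AE[OF ih] h0 by simp
    moreover have "AE s in lebesgue. s \<noteq> (1::real)"
      by (intro AE_completion AE_lborel_singleton)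
    ultimately have "AE s in lebesgue. ?g s = 0" by eventually_elim (simp add: h_eq)
    then have "integral\<^sup>L lebesgue ?g = 0" by (rule integral_eq_zero_AE)
    then show False using pos by (simp add: set_lebesgue_integral_def)
  qed
  moreover have "integral\<^sup>L lebesgue ?h \<ge> 0" by (intro integral_nonneg_AE AE_I2 h0)
  ultimately show "(LINT s:{0..1}|lebesgue. (1 - s) * g s) > 0"
    by (simp add: set_lebesgue_integral_def)
qed

lemma k1_eq: "k1 t s = 2 - max t s"
  and k2_eq: "k2 t s = 1 / 2 - max t s"
  by (simp_all add: k1_def k2_def max_def)

lemma sup_norm01_eqI:
  assumes "\<And>t. t \<in> {0..1} \<Longrightarrow> \<bar>u t\<bar> \<le> r" "t \<in> {0..1}" "\<bar>u t\<bar> = r"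
  shows "sup_norm01 u = r"
  unfolding sup_norm01_def by (rule cSup_eq_maximum) (use assms in auto)

theorem theorem3p3:
  fixes f g :: "real \<times> real \<times> real \<Rightarrow> real"
    and f_low g_low :: "real \<Rightarrow> real"
    and r1 r2 :: real
  assumes f_cont: "continuous_on ({0..1} \<times> {0..} \<times> UNIV) f"
    and f_nonneg: "\<And>t u v. t \<in> {0..1} \<Longrightarrow> u \<ge> 0 \<Longrightarrow> f (t, u, v) \<ge> 0"
    and g_cont: "continuous_on ({0..1} \<times> {0..} \<times> UNIV) g"
    and g_nonneg: "\<And>t u v. t \<in> {0..1} \<Longrightarrow> u \<ge> 0 \<Longrightarrow> g (t, u, v) \<ge> 0"
    and r1: "r1 > 0" and r2: "r2 > 0"
    and f_low_meas: "f_low \<in> borel_measurable (lebesgue_on {0..1})"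
    and f_low_nonneg: "\<And>t. t \<in> {0..1} \<Longrightarrow> f_low t \<ge> 0"
    and g_low_meas: "g_low \<in> borel_measurable (lebesgue_on {0..1})"
    and g_low_nonneg: "\<And>t. t \<in> {0..1} \<Longrightarrow> g_low t \<ge> 0"
    and f_ge: "\<And>t u v. t \<in> {0..1} \<Longrightarrow> u \<in> {r1 / 2..r1} \<Longrightarrow> v \<in> {- r2..r2} \<Longrightarrow>
                 f (t, u, v) \<ge> f_low t"
    and f_low_pos: "(SUP t\<in>{0..1}. LINT s:{0..1}|lebesgue. k1 t s * f_low s) > 0"
    and g_ge: "\<And>t u v. t \<in> {0..1} \<Longrightarrow> u \<in> {r1 / 2..r1} \<Longrightarrow> v \<in> {- r2..r2} \<Longrightarrow>
                 g (t, u, v) \<ge> g_low t"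
    and g_low_pos: "(LINT s:{0..1}|lebesgue. g_low s) > 0"
  shows "\<exists>(lam1 :: nat \<Rightarrow> real) (lam2 :: nat \<Rightarrow> real)
          (u0 :: nat \<Rightarrow> real \<Rightarrow> real) (v0 :: nat \<Rightarrow> real \<Rightarrow> real).
           lam1 1 > 0 \<and> lam2 1 > 0 \<and> lam1 2 > 0 \<and> lam2 2 < 0 \<and>
           (\<forall>j\<in>{1, 2}.
              (u0 j, v0 j) \<in> Kbar r1 \<times> Bbar r2 \<and>
              sup_norm01 (u0 j) = r1 \<and> sup_norm01 (v0 j) = r2 \<and>
              (\<forall>t\<in>{0..1}.
                 u0 j t = lam1 j * (LINT s:{0..1}|lebesgue. k1 t s * f (s, u0 j s, v0 j s)) \<and>
                 v0 j t = lam2 j * (LINT s:{0..1}|lebesgue. k2 t s * g (s, u0 j s, v0 j s))))"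
proof -
  define D where "D = {0..1::real} \<times> {r1/2..r1} \<times> {-r2..r2}"
  have "D \<subseteq> {0..1} \<times> {0..} \<times> UNIV" using r1 by (auto simp: D_def)
  then have fD: "continuous_on D f" and gD: "continuous_on D g"
    using f_cont g_cont continuous_on_subset by blast+
  have f0: "f p \<ge> 0" and g0: "g p \<ge> 0" if "p \<in> D" for p
    using that f_nonneg g_nonneg r1 by (auto simp: D_def)
  have along: "continuous_on {0..1} (\<lambda>s. h (s, u s, v s))"
    if "continuous_on D h" "continuous_on {0..1} u" "continuous_on {0..1} v"
      "\<And>s. s \<in> {0..1} \<Longrightarrow> (s, u s, v s) \<in> D" for u v and h :: "real \<times> real \<times> real \<Rightarrow> real"
    using that(4) by (intro continuous_on_compose2[OF that(1)] continuous_on_Pair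
        continuous_on_id that(2,3)) blast
  \<comment> \<open>One point \<tau> with a positive integral suffices: the first component is
    decreasing, so a lower bound at \<tau> is also one at 0.\<close>
  have "\<exists>t\<in>{0..1}. (LINT s:{0..1}|lebesgue. k1 t s * f_low s) > 0"
  proof (rule ccontr)
    assume "\<not> ?thesis"
    then have "(SUP t\<in>{0..1}. LINT s:{0..1}|lebesgue. k1 t s * f_low s) \<le> 0"
      by (intro cSUP_least) (auto simp: not_less)
    then show False using f_low_pos by simp
  qed
  then obtain \<tau> where \<tau>: "\<tau> \<in> {0..1}" and pos: "(LINT s:{0..1}|lebesgue. k1 \<tau> s * f_low s) > 0"
    by blast
  define c\<^sub>f where "c\<^sub>f = (LINT s:{0..1}|lebesgue. k1 \<tau> s * f_low s)"
  define c\<^sub>g where "c\<^sub>g = (LINT s:{0..1}|lebesgue. (1 - s) * g_low s)"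
  have cf: "c\<^sub>f \<le> kernel_op 2 (\<lambda>s. f (s, u s, v s)) 0"
    if u: "continuous_on {0..1} u" and v: "continuous_on {0..1} v"
      and D: "\<And>s. s \<in> {0..1} \<Longrightarrow> (s, u s, v s) \<in> D" for u v
  proof -
    have "c\<^sub>f \<le> kernel_op 2 (\<lambda>s. f (s, u s, v s)) \<tau>"
      unfolding c\<^sub>f_def kernel_op_def k1_eq
    proof (rule set_integral_mono)
      \<comment> \<open>Integrability is again read off from the nonzero value of the
        integral.\<close>
      show "set_integrable lebesgue {0..1} (\<lambda>s. (2 - max \<tau> s) * f_low s)"
        using pos not_integrable_integral_eq
        unfolding set_lebesgue_integral_def set_integrable_def k1_eq by fastforce
      show "(2 - max \<tau> s) * f_low s \<le> (2 - max \<tau> s) * f (s, u s, v s)" if "s \<in> {0..1}" for s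
        using that \<tau> D[OF that] by (intro mult_left_mono f_ge) (auto simp: D_def)
    qed (intro kernel_integrable along fD u v D)
    also have "\<dots> \<le> kernel_op 2 (\<lambda>s. f (s, u s, v s)) 0"
      using \<tau> by (intro kernel_op_antimono along fD u v D f0) auto
    finally show ?thesis .
  qed
  have cg: "c\<^sub>g \<le> kernel_op (1/2) (\<lambda>s. g (s, u s, v s)) 0 - kernel_op (1/2) (\<lambda>s. g (s, u s, v s)) 1"
    if u: "continuous_on {0..1} u" and v: "continuous_on {0..1} v"
      and D: "\<And>s. s \<in> {0..1} \<Longrightarrow> (s, u s, v s) \<in> D" for u v
  proof -
    let ?h = "\<lambda>s. g (s, u s, v s)"
    have h: "continuous_on {0..1} ?h" by (intro along gD u v D)
    have "c\<^sub>g \<le> (LINT s:{0..1}|lebesgue. (1/2 - max 0 s) * ?h s - (1/2 - max 1 s) * ?h s)"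
      unfolding c\<^sub>g_def
    proof (rule set_integral_mono)
      show "set_integrable lebesgue {0..1} (\<lambda>s. (1 - s) * g_low s)"
        by (rule weighted_integral_pos[OF g_low_nonneg g_low_pos])
      show "(1 - s) * g_low s \<le> (1/2 - max 0 s) * ?h s - (1/2 - max 1 s) * ?h s"
        if "s \<in> {0..1}" for s
      proof -
        have "(1 - s) * g_low s \<le> (1 - s) * ?h s"
          using that D[OF that] by (intro mult_left_mono g_ge) (auto simp: D_def)
        moreover have "max 0 s = s" "max 1 s = 1" using that by auto
        ultimately show ?thesis by (simp add: algebra_simps)
      qed
    qed (intro set_integral_diff(1) kernel_integrable h)
    also have "\<dots> = kernel_op (1/2) ?h 0 - kernel_op (1/2) ?h 1"
      unfolding kernel_op_def by (intro set_integral_diff(2) kernel_integrable h)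
    finally show ?thesis .
  qed
  have cpos: "c\<^sub>f > 0" "c\<^sub>g > 0"
    using pos weighted_integral_pos(2)[OF g_low_nonneg g_low_pos] by (simp_all add: c\<^sub>f_def c\<^sub>g_def)
  \<comment> \<open>Since \<beta> is positive, the second eigenvalue has the sign of \<sigma>; the
    values 1 and -1 give the two pairs.\<close>
  have sol: "\<exists>\<alpha> \<beta> u v. \<alpha> > 0 \<and> \<beta> > 0 \<and> (u, v) \<in> Kbar r1 \<times> Bbar r2 \<and> sup_norm01 u = r1 \<and> sup_norm01 v = r2 \<and>
      (\<forall>t\<in>{0..1}. u t = \<alpha> * (LINT s:{0..1}|lebesgue. k1 t s * f (s, u s, v s)) \<and>
        v t = \<sigma> * \<beta> * (LINT s:{0..1}|lebesgue. k2 t s * g (s, u s, v s)))"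
    if \<sigma>: "\<bar>\<sigma>\<bar> = 1" for \<sigma> :: real
  proof -
    obtain \<alpha> \<beta> u v where \<alpha>: "\<alpha> > 0" and \<beta>: "\<beta> > 0"
      and u: "continuous_on {0..1} u" and v: "continuous_on {0..1} v"
      and D: "\<And>s. s \<in> {0..1} \<Longrightarrow> (s, u s, v s) \<in> D"
      and u0: "u 0 = r1" and v01: "max \<bar>v 0\<bar> \<bar>v 1\<bar> = r2"
      and ueq: "\<And>t. t \<in> {0..1} \<Longrightarrow> u t = \<alpha> * kernel_op 2 (\<lambda>s. f (s, u s, v s)) t"
      and veq: "\<And>t. t \<in> {0..1} \<Longrightarrow> v t = \<sigma> * \<beta> * kernel_op (1/2) (\<lambda>s. g (s, u s, v s)) t"
      using hammerstein_eigenpair[OF r1 r2 \<sigma>, folded D_def, OF fD f0 gD g0 cpos(1) cf cpos(2) cg]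
      by blast
    have nu: "sup_norm01 u = r1"
      using D u0 r1 by (intro sup_norm01_eqI[of _ _ 0]) (force simp: D_def)+
    have nv: "sup_norm01 v = r2"
    proof (rule sup_norm01_eqI)
      show "\<bar>v t\<bar> \<le> r2" if "t \<in> {0..1}" for t using D[OF that] by (auto simp: D_def)
      \<comment> \<open>The witness is an endpoint at which the maximum in \<open>v01\<close> is
        attained.\<close>
      show "\<bar>v (if \<bar>v 0\<bar> = r2 then 0 else 1)\<bar> = r2" using v01 by (auto simp: max_def split: if_splits)
    qed auto
    have "(1 - t / 2) * r1 \<le> u t" if t: "t \<in> {0..1}" for t
    proof -
      have "(1 - t / 2) * r1 = \<alpha> * ((1 - t / 2) * kernel_op 2 (\<lambda>s. f (s, u s, v s)) 0)"
        using ueq[of 0] u0 by simp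
      also have "\<dots> \<le> u t"
        unfolding ueq[OF t] using \<alpha> t by (intro mult_left_mono kernel_op_2_ge along fD u v D f0) auto
      finally show ?thesis .
    qed
    then have "(u, v) \<in> Kbar r1 \<times> Bbar r2"
      using u v nu nv by (simp add: Kbar_def Bbar_def cone_K_def C01_def)
    then show ?thesis
      using \<alpha> \<beta> nu nv ueq veq unfolding kernel_op_def k1_eq[symmetric] k2_eq[symmetric] by blast
  qed
  obtain \<alpha> \<beta> u v where 1: "\<alpha> > 0" "\<beta> > 0" "(u, v) \<in> Kbar r1 \<times> Bbar r2"
      "sup_norm01 u = r1" "sup_norm01 v = r2"
      "\<forall>t\<in>{0..1}. u t = \<alpha> * (LINT s:{0..1}|lebesgue. k1 t s * f (s, u s, v s)) \<and>
        v t = \<beta> * (LINT s:{0..1}|lebesgue. k2 t s * g (s, u s, v s))"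
    using sol[of 1] by auto
  obtain \<alpha>' \<beta>' u' v' where 2: "\<alpha>' > 0" "\<beta>' > 0" "(u', v') \<in> Kbar r1 \<times> Bbar r2"
      "sup_norm01 u' = r1" "sup_norm01 v' = r2"
      "\<forall>t\<in>{0..1}. u' t = \<alpha>' * (LINT s:{0..1}|lebesgue. k1 t s * f (s, u' s, v' s)) \<and>
        v' t = - \<beta>' * (LINT s:{0..1}|lebesgue. k2 t s * g (s, u' s, v' s))"
    using sol[of "-1"] by auto
  show ?thesis
    by (rule exI[of _ "\<lambda>j. if j = 1 then \<alpha> else \<alpha>'"], rule exI[of _ "\<lambda>j. if j = 1 then \<beta> else - \<beta>'"],
        rule exI[of _ "\<lambda>j. if j = 1 then u else u'"], rule exI[of _ "\<lambda>j. if j = 1 then v else v'"])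
      (use 1 2 in simp)
qed

end
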